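(* Let $\delta>0$, let $\alpha_1,\alpha_2\ge\frac12\pi$, and let $\mathbf{S}$ be the sector $-\alpha_1+\delta\le\arg t\le\alpha_2-\delta$. Let $R>0$, $\mu>0$, let $\beta\in\mathbb{C}$ with $\Re(\beta)>0$, and suppose that the function $f$ satisfies the following conditions: (i) $f(t)$ is holomorphic in the sector $\mathbf{S}$; (ii) $f(t)$ possesses the absolutely convergent expansion $$f(t)=\sum_{n=0}^\infty c_n\, t^{\frac{n+\beta}{\mu}-1}\qquad (|t|<R);$$ (iii) $|f(t)|\le A e^{\sigma|t|}$ for $t\in\mathbf{S}$, where $A$ and $\sigma$ are positive constants. For complex $z$ of large modulus with $|\arg z|\le\frac12\pi-\delta$, let $$I(z)=\int_0^\infty e^{-zt}f(t)\,dt .$$ Let $r$ be a fixed positive number such that $r<R$, and let $n_*=\lfloor \mu r|z|+\mu-\Re(\beta)\rfloor$. Then $$I(z)=\sum_{0\le n\le n_*}\frac{c_n}{z^{(n+\beta)/\mu}}\,\Gamma\!\left(\frac{n+\beta}{\mu}\right)+R_{n_*}(z),$$ where the remainder $R_{n_*}(z)$ satisfies the bound $$R_{n_*}(z)=O(e^{-r|z|})$$ as $|z|\to\infty$ in the sector $|\arg z|\le\frac12\pi-\delta$.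
   Context: Here $\Gamma$ is the Euler gamma function and $\lfloor\cdot\rfloor$ is the floor function. The coefficients $c_n$ are complex numbers. The function $f$ may have a branch point at $t=0$: the vertex $t=0$ is not regarded as part of the sector $\mathbf{S}$, the powers $t^{(n+\beta)/\mu-1}$ are defined by $t^{s}=|t|^{s}e^{is\arg t}$ with $\arg t$ varying continuously over the sector and equal to $0$ on the positive real axis, and the expansion in (ii) holds for $t\in\mathbf{S}$ with $|t|<R$. Powers of $z$ are given by $z^{s}=|z|^{s}e^{is\arg z}$ with $|\arg z|\le\frac12\pi-\delta$. The truncation index $n_*$ depends on $|z|$. The integral defining $I(z)$ is taken along the positive real axis. *)

theory Defs
  imports "HOL-Complex_Analysis.Complex_Analysis" "HOL-Library.Landau_Symbols"
begin

text \<open>The opening angle of the sector may exceed \<open>2 * pi\<close>, so its points live on the Riemann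
  surface of the logarithm. Such a point \<open>t\<close> is encoded by the pair \<open>(\<bar>t\<bar>, arg t)\<close> with \<open>\<bar>t\<bar> > 0\<close>
  and \<open>arg t\<close> not reduced modulo \<open>2 * pi\<close>; pairs with nonpositive first component encode nothing.\<close>

type_synonym lpoint = "real \<times> real"

definition lproj :: "lpoint \<Rightarrow> complex" where
  "lproj t = complex_of_real (fst t) * exp (\<i> * complex_of_real (snd t))"

definition lpow :: "lpoint \<Rightarrow> complex \<Rightarrow> complex" where
  "lpow t s = complex_of_real (fst t) powr s * exp (\<i> * s * complex_of_real (snd t))"

definition lsector :: "real \<Rightarrow> real \<Rightarrow> lpoint set" where
  "lsector a b = {(\<rho>, \<theta>). 0 < \<rho> \<and> a \<le> \<theta> \<and> \<theta> \<le> b}"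

text \<open>The logarithm \<open>log t = ln \<bar>t\<bar> + i arg t\<close> is a global holomorphic coordinate on the surface;
  \<open>of_log\<close> is its inverse. As \<open>S\<close> may contain boundary points, differentiability
  is relative to \<open>S\<close>, as in \<^const>\<open>holomorphic_on\<close>.\<close>

definition of_log :: "complex \<Rightarrow> lpoint" where
  "of_log w = (exp (Re w), Im w)"

definition lholomorphic_on :: "(lpoint \<Rightarrow> complex) \<Rightarrow> lpoint set \<Rightarrow> bool" where
  "lholomorphic_on f S \<longleftrightarrow> (\<lambda>w. f (of_log w)) holomorphic_on {w. of_log w \<in> S}"

lemma lproj_of_log: "lproj (of_log w) = exp w"
  unfolding lproj_def of_log_def exp_eq_polar[of w] cis_conv_exp by simp

text \<open>For sectors that stay off the cut, the notions above are the usual ones.\<close>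

lemma Ln_lproj:
  assumes "0 < fst t" "\<bar>snd t\<bar> < pi"
  shows "Ln (lproj t) = of_real (ln (fst t)) + \<i> * of_real (snd t)"
proof -
  have "complex_of_real (fst t) = exp (of_real (ln (fst t)))"
    using assms by (simp add: exp_of_real)
  then have "lproj t = exp (of_real (ln (fst t)) + \<i> * of_real (snd t))"
    unfolding lproj_def exp_add by (rule arg_cong)
  then show ?thesis
    using assms by simp
qed

lemma of_log_Ln_lproj:
  assumes "0 < fst t" "\<bar>snd t\<bar> < pi"
  shows "of_log (Ln (lproj t)) = t"
  unfolding Ln_lproj[OF assms] of_log_def using assms by simp

lemma lpow_eq_powr:
  assumes "0 < fst t" "\<bar>snd t\<bar> < pi"
  shows "lpow t s = lproj t powr s"
proof -
  have 0: "lproj t \<noteq> 0" "complex_of_real (fst t) \<noteq> 0"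
    using assms by (simp_all add: lproj_def)
  have "lproj t powr s = exp (s * of_real (ln (fst t)) + \<i> * s * of_real (snd t))"
    unfolding powr_def if_not_P[OF 0(1)] Ln_lproj[OF assms]
    by (rule arg_cong[where f = exp]) (simp only: distrib_left mult.assoc mult.left_commute)
  also have "\<dots> = lpow t s"
    unfolding exp_add lpow_def powr_def if_not_P[OF 0(2)] Ln_of_real[OF assms(1)] ..
  finally show ?thesis by simp
qed

lemma lholomorphic_on_lproj_iff:
  assumes S: "\<And>t. t \<in> S \<Longrightarrow> 0 < fst t \<and> \<bar>snd t\<bar> < pi"
  shows "lholomorphic_on (\<lambda>t. g (lproj t)) S \<longleftrightarrow> g holomorphic_on lproj ` S"
proof
  assume "lholomorphic_on (\<lambda>t. g (lproj t)) S"
  then have h: "(\<lambda>w. g (exp w)) holomorphic_on {w. of_log w \<in> S}"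
    by (simp add: lholomorphic_on_def lproj_of_log)
  have 0: "z \<noteq> 0" if "z \<in> lproj ` S" for z
    using that S by (force simp: lproj_def)
  have nz: "z \<notin> \<real>\<^sub>\<le>\<^sub>0" if z: "z \<in> lproj ` S" for z
  proof
    assume "z \<in> \<real>\<^sub>\<le>\<^sub>0"
    then have "Im (Ln z) = pi"
      using 0[OF z] by (auto simp: Im_Ln_eq_pi complex_nonpos_Reals_iff complex_eq_iff)
    moreover obtain t where t: "t \<in> S" "z = lproj t"
      using z by blast
    ultimately show False
      using S[OF t(1)] Ln_lproj[of t] by simp
  qed
  have "(\<lambda>w. g (exp w)) \<circ> Ln holomorphic_on lproj ` S"
  proof (rule holomorphic_on_compose_gen[OF _ h])
    show "Ln holomorphic_on lproj ` S"
      using nz by (intro holomorphic_on_Ln) blast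
    show "Ln ` (lproj ` S) \<subseteq> {w. of_log w \<in> S}"
      using S of_log_Ln_lproj by auto
  qed
  then show "g holomorphic_on lproj ` S"
    by (rule holomorphic_transform) (simp add: 0)
next
  assume g: "g holomorphic_on lproj ` S"
  have "exp ` {w. of_log w \<in> S} \<subseteq> lproj ` S"
    by (metis (no_types, lifting) image_eqI image_subsetI lproj_of_log mem_Collect_eq)
  then have "g \<circ> exp holomorphic_on {w. of_log w \<in> S}"
    by (intro holomorphic_on_compose_gen[OF holomorphic_on_exp g])
  then show "lholomorphic_on (\<lambda>t. g (lproj t)) S"
    by (simp add: lholomorphic_on_def lproj_of_log o_def)
qed

definition laplace :: "(lpoint \<Rightarrow> complex) \<Rightarrow> complex \<Rightarrow> complex" where
  "laplace f z = (LBINT t:{0<..}. exp (- z * complex_of_real t) * f (t, 0))"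

end

theory Submission imports Defs "HOL-Real_Asymp.Real_Asymp"
begin

text \<open>Watson's lemma with optimal truncation.

  The ray of integration is turned to \<open>arg t = - Arg z\<close>, where the kernel becomes
  \<open>exp (- norm z * \<bar>t\<bar>)\<close>. The turn stays inside the sector and keeps the kernel decaying at a rate at
  least \<open>norm z * sin \<delta>\<close>, which beats the growth of \<open>f\<close> once \<open>norm z\<close> is large; in the coordinate
  \<open>log t\<close> it is Cauchy's theorem for long rectangles (\<open>laplace_ray_rotation\<close>). On the turned ray, the
  term of index \<open>n\<close> of the expansion integrates to the term of index \<open>n\<close> of the asymptotic series
  (\<open>ray_integral_lpow\<close>), so the remainder is the integral of \<open>f\<close> minus its truncated expansion.

  Put \<open>X = r * norm z\<close> and choose \<open>\<rho>\<close> with \<open>r < \<rho> < R\<close>. The truncation index is such that exactly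
  the terms whose exponent has real part at most \<open>X\<close> are kept. For \<open>\<bar>t\<bar> \<le> \<rho>\<close> the discarded terms,
  and for \<open>\<bar>t\<bar> \<ge> \<rho>\<close> the kept ones, are therefore bounded by a constant times \<open>(\<bar>t\<bar> / \<rho>) powr X\<close>
  (\<open>truncated_powr_series_bound\<close>); the constant is finite because the expansion converges
  absolutely at \<open>\<rho>\<close>. Finally \<open>(\<bar>t\<bar> / \<rho>) powr X \<le> exp (X * (\<bar>t\<bar> / \<rho> - 1))\<close>. Together with the kernel this
  is \<open>exp (- r * norm z)\<close> times \<open>exp (- (1 - r / \<rho>) * norm z * \<bar>t\<bar>)\<close>, which is integrable along the
  ray. The contribution of \<open>f\<close> itself beyond \<open>\<rho>\<close> has a bound of the same kind by the growth
  condition (\<open>ray_remainder_bound\<close>).\<close>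

section \<open>Laplace integrals of powers\<close>

lemma set_integrable_exp_decay:
  fixes k :: real
  assumes "k > 0"
  shows "set_integrable lborel {0<..} (\<lambda>t. exp (- k * t))"
    and "(LBINT t:{0<..}. exp (- k * t)) = 1 / k"
proof -
  have nn: "(\<lambda>t. exp (- k * t)) absolutely_integrable_on {0..}"
    using has_integral_exp_minus_to_infinity[OF assms, of 0]
    by (intro nonnegative_absolutely_integrable_1) auto
  show int: "set_integrable lborel {0<..} (\<lambda>t. exp (- k * t))"
    using set_integrable_subset[OF nn, of "{0<..}"] Ioi_le_Ico[of "0 :: real"]
    by (simp add: set_integrable_def integrable_completion)
  have "((\<lambda>t. exp (- k * t)) has_integral 1 / k) {0<..}"
    using has_integral_exp_minus_to_infinity[OF assms, of 0]
    by (subst (asm) has_integral_spike_set_eq[where T = "{0<..}"])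
      (auto intro: negligible_subset[of "{0}"])
  then show "(LBINT t:{0<..}. exp (- k * t)) = 1 / k"
    using set_borel_integral_eq_integral(2)[OF int] by (simp add: integral_unique)
qed

text \<open>Euler's integral after the scaling \<open>t \<mapsto> x * t\<close> with real \<open>x\<close>. Real scalings suffice,
  because the ray of integration is rotated before the expansion of the integrand is used.\<close>

lemma laplace_powr:
  fixes x :: real and s :: complex
  assumes x: "x > 0" and s: "Re s > 0"
  shows "set_integrable lborel {0<..} (\<lambda>t. exp (- of_real (x * t)) * of_real t powr (s - 1))"
    and "(LBINT t:{0<..}. exp (- of_real (x * t)) * of_real t powr (s - 1)) =
         Gamma s / of_real x powr s"
proof -
  define g :: "real \<Rightarrow> complex" where "g = (\<lambda>t. of_real t powr (s - 1) / of_real (exp t))"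
  define h where "h = (\<lambda>t. indicator {0<..} t *\<^sub>R g t)"
  define e where "e = (\<lambda>t. indicator {0<..} t *\<^sub>R (exp (- of_real (x * t)) * of_real t powr (s - 1)))"
  have "continuous_on {0<..} g"
    unfolding g_def by (intro continuous_intros) auto
  then have meas: "h \<in> borel_measurable lborel"
    unfolding h_def by (simp add: borel_measurable_continuous_on_indicator)
  have int: "set_integrable lborel {0<..} g"
    using absolutely_integrable_Gamma_integral'[OF s] meas
    unfolding g_def h_def set_integrable_def by (subst (asm) integrable_completion) auto
  have val: "(LBINT t:{0<..}. g t) = Gamma s"
    using set_borel_integral_eq_integral(2)[OF int] Gamma_integral_complex'[OF s]
    by (simp add: integral_unique g_def)
  have scale: "h (0 + x * t) = of_real x powr (s - 1) * e t" for t
  proof (cases "t > 0")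
    case True
    then have "complex_of_real (x * t) powr (s - 1) = of_real x powr (s - 1) * of_real t powr (s - 1)"
      using x unfolding of_real_mult by (intro powr_times_real) auto
    then show ?thesis
      using x True by (simp add: h_def g_def e_def exp_minus exp_of_real divide_inverse flip: of_real_mult)
  qed (use x in \<open>auto simp: h_def e_def zero_less_mult_iff\<close>)
  have nz: "complex_of_real x powr (s - 1) \<noteq> 0"
    using x by simp
  have "integrable lborel h"
    using int by (simp add: set_integrable_def h_def)
  then have "integrable lborel (\<lambda>t. h (0 + x * t))"
    using x by (subst lborel_integrable_real_affine_iff) auto
  then have "integrable lborel (\<lambda>t. of_real x powr (s - 1) * e t / of_real x powr (s - 1))"
    unfolding scale by (rule integrable_divide)
  then have "integrable lborel e"
    using nz by (metis (no_types, lifting) Bochner_Integration.integrable_cong nonzero_mult_div_cancel_left)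
  then show "set_integrable lborel {0<..} (\<lambda>t. exp (- of_real (x * t)) * of_real t powr (s - 1))"
    by (simp add: set_integrable_def e_def)
  have "Gamma s = integral\<^sup>L lborel h"
    using val by (simp add: set_lebesgue_integral_def h_def)
  also have "\<dots> = \<bar>x\<bar> *\<^sub>R (\<integral>t. h (0 + x * t) \<partial>lborel)"
    using x by (intro lborel_integral_real_affine) auto
  also have "\<dots> = of_real x powr s * integral\<^sup>L lborel e"
    unfolding scale using x by (simp add: scaleR_conv_of_real powr_diff)
  finally show "(LBINT t:{0<..}. exp (- of_real (x * t)) * of_real t powr (s - 1)) =
         Gamma s / of_real x powr s"
    using x by (simp add: set_lebesgue_integral_def e_def field_simps)
qed

section \<open>Rotating the ray of integration\<close>

text \<open>Cauchy's theorem for a rectangle: the two horizontal sides differ by the two vertical ones,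
  which are estimated trivially. Only differentiability relative to the closed strip is available,
  so the argument uses a primitive on the convex strip, which exists because the function is
  continuous there and holomorphic in the interior. The number \<open>\<theta>\<close> may have either sign, and for
  \<open>\<theta> = 0\<close> the strip has empty interior.\<close>

lemma Cauchy_horizontal_segments:
  fixes G :: "complex \<Rightarrow> complex" and a b \<theta> Ba Bb :: real
  defines "S \<equiv> {w. Im w \<in> closed_segment 0 \<theta>}"
  assumes "a < b" and G: "G holomorphic_on S"
    and Ba: "\<And>w. w \<in> S \<Longrightarrow> Re w = a \<Longrightarrow> norm (G w) \<le> Ba"
    and Bb: "\<And>w. w \<in> S \<Longrightarrow> Re w = b \<Longrightarrow> norm (G w) \<le> Bb"
  shows "norm (integral {a..b} (\<lambda>u. G (of_real u)) - integral {a..b} (\<lambda>u. G (of_real u + \<i> * of_real \<theta>)))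
         \<le> (Ba + Bb) * \<bar>\<theta>\<bar>"
proof -
  have "S = Im -` closed_segment 0 \<theta>"
    by (auto simp: S_def)
  moreover have "linear Im"
    by (intro bounded_linear.linear bounded_linear_Im)
  ultimately have "convex S"
    by (simp add: convex_linear_vimage)
  moreover have "G field_differentiable at x" if "x \<in> interior S - {}" for x
    using G that holomorphic_on_imp_differentiable_at[of G "interior S" x]
    by (auto intro: holomorphic_on_subset interior_subset[THEN subsetD])
  ultimately obtain P where P: "\<And>w. w \<in> S \<Longrightarrow> (P has_field_derivative G w) (at w within S)"
    using G holomorphic_convex_primitive[of S "{}" G] holomorphic_on_imp_continuous_on by blast
  have line: "(G has_contour_integral (P q - P p)) (linepath p q)" if "p \<in> S" "q \<in> S" for p q
  proof -
    have "closed_segment p q \<subseteq> S"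
      using \<open>convex S\<close> that by (simp add: closed_segment_subset)
    then show ?thesis
      using contour_integral_primitive[OF P valid_path_linepath, of p q] by simp
  qed
  have horizontal: "integral {a..b} (\<lambda>u. G (of_real u + \<i> * of_real y)) =
      P (of_real b + \<i> * of_real y) - P (of_real a + \<i> * of_real y)"
    if y: "y \<in> closed_segment 0 \<theta>" for y
  proof (intro integral_unique fundamental_theorem_of_calculus)
    fix u
    define m where "m = (\<lambda>v. complex_of_real v + \<i> * of_real y)"
    have "(m has_vector_derivative 1) (at u within {a..b})"
      unfolding m_def by (auto intro!: derivative_eq_intros)
    moreover have "(P has_field_derivative G (m u)) (at (m u) within m ` {a..b})"
      using y by (intro DERIV_subset[OF P]) (auto simp: S_def m_def)
    ultimately show "((\<lambda>v. P (of_real v + \<i> * of_real y)) has_vector_derivative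
        G (of_real u + \<i> * of_real y)) (at u within {a..b})"
      using field_vector_diff_chain_within[of m 1 u "{a..b}" P "G (m u)"] by (simp add: m_def o_def)
  qed (use \<open>a < b\<close> in simp)
  have side: "norm (P (of_real x + \<i> * of_real \<theta>) - P (of_real x)) \<le> B * \<bar>\<theta>\<bar>"
    if B: "\<And>w. w \<in> S \<Longrightarrow> Re w = x \<Longrightarrow> norm (G w) \<le> B" for x B
  proof -
    define v v' where vdefs: "v = complex_of_real x" "v' = of_real x + \<i> * of_real \<theta>"
    have vS: "v \<in> S" "v' \<in> S"
      by (auto simp: vdefs S_def)
    have seg: "closed_segment v v' \<subseteq> S"
      using \<open>convex S\<close> vS by (simp add: closed_segment_subset)
    have "norm (G w) \<le> B" if "w \<in> closed_segment v v'" for w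
    proof (rule B)
      show "w \<in> S"
        using that seg by blast
      show "Re w = x"
        using that by (auto simp: vdefs in_segment algebra_simps)
    qed
    moreover have "0 \<le> B"
      using B[OF vS(1)] by (simp add: vdefs) (metis norm_ge_zero order_trans)
    ultimately have "norm (P v' - P v) \<le> B * norm (v' - v)"
      using has_contour_integral_bound_linepath[OF line[OF vS]] by blast
    then show ?thesis
      by (simp add: vdefs norm_mult)
  qed
  define d where "d = (\<lambda>x. P (of_real x + \<i> * of_real \<theta>) - P (of_real x))"
  have "integral {a..b} (\<lambda>u. G (of_real u)) - integral {a..b} (\<lambda>u. G (of_real u + \<i> * of_real \<theta>)) =
      d a - d b"
    using horizontal[of 0] horizontal[of \<theta>] by (simp add: d_def)
  also have "norm \<dots> \<le> Ba * \<bar>\<theta>\<bar> + Bb * \<bar>\<theta>\<bar>"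
    unfolding d_def by (intro order_trans[OF norm_triangle_ineq4] add_mono side Ba Bb)
  finally show ?thesis
    by (simp add: algebra_simps)
qed

text \<open>In the variable \<open>u = ln t\<close> a ray becomes a whole horizontal line, on which both the branch
  point and infinity lie at infinite distance. Symmetric truncations of the line are the
  horizontal sides to which Cauchy's theorem applies.\<close>

lemma integral_exp_substitution_tendsto:
  fixes F :: "real \<Rightarrow> complex"
  assumes cont: "continuous_on {0<..} F" and int: "set_integrable lborel {0<..} F"
  shows "(\<lambda>n. integral {- real (Suc n)..real (Suc n)} (\<lambda>u. exp u *\<^sub>R F (exp u)))
         \<longlonglongrightarrow> (LBINT t:{0<..}. F t)"
proof -
  define l where "l = (\<lambda>n. exp (- real (Suc n)))"
  define u where "u = (\<lambda>n. exp (real (Suc n)))"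
  have ein: "einterval 0 \<infinity> = {0<..}"
    by (auto simp: einterval_iff)
  have l0: "l \<longlonglongrightarrow> 0" and ui: "filterlim u at_top sequentially"
    unfolding l_def u_def by real_asymp+
  have cover: "einterval 0 \<infinity> = (\<Union>i. {l i..u i})"
  proof (intro set_eqI iffI)
    fix x assume "x \<in> einterval 0 \<infinity>"
    then have "0 < x"
      by (simp add: ein)
    then have "eventually (\<lambda>i. l i < x \<and> x \<le> u i) sequentially"
      using order_tendstoD(2)[OF l0, of x] ui by (auto simp: filterlim_at_top intro: eventually_conj)
    then show "x \<in> (\<Union>i. {l i..u i})"
      using eventually_happens'[OF sequentially_bot] by force
  qed (auto simp: ein l_def intro: less_le_trans[OF exp_gt_zero])
  have "(\<lambda>n. LBINT x=l n..u n. F x) \<longlonglongrightarrow> (LBINT x=0..\<infinity>. F x)"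
  proof (rule interval_integral_Icc_approx_integrable[OF _ cover])
    show "(\<lambda>x. ereal (l x)) \<longlonglongrightarrow> 0"
      using l0 by (simp add: zero_ereal_def)
    show "(\<lambda>x. ereal (u x)) \<longlonglongrightarrow> \<infinity>"
      using ui by (simp add: tendsto_PInfty_eq_at_top)
    show "incseq u" "decseq l"
      by (auto simp: incseq_def decseq_def u_def l_def)
  qed (use int in \<open>auto simp: ein l_def u_def\<close>)
  also have "(LBINT x=0..\<infinity>. F x) = (LBINT t:{0<..}. F t)"
    using interval_integral_Ioi[of 0 F] by simp
  also have "(\<lambda>n. LBINT x=l n..u n. F x) =
      (\<lambda>n. integral {- real (Suc n)..real (Suc n)} (\<lambda>u. exp u *\<^sub>R F (exp u)))"
  proof
    fix n
    have contE: "continuous_on {- real (Suc n)..real (Suc n)} (\<lambda>u. exp u *\<^sub>R F (exp u))"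
      by (intro continuous_intros continuous_on_compose2[OF cont]) auto
    have "(LBINT x=l n..u n. F x) = (LBINT x=- real (Suc n)..real (Suc n). exp x *\<^sub>R F (exp x))"
      unfolding l_def u_def
      by (rule interval_integral_substitution_finite[symmetric])
        (auto intro!: derivative_eq_intros continuous_intros continuous_on_subset[OF cont])
    also have "\<dots> = integral {- real (Suc n)..real (Suc n)} (\<lambda>u. exp u *\<^sub>R F (exp u))"
      using borel_integrable_atLeastAtMost'[OF contE]
      by (intro interval_integral_eq_integral) auto
    finally show "(LBINT x=l n..u n. F x) =
      integral {- real (Suc n)..real (Suc n)} (\<lambda>u. exp u *\<^sub>R F (exp u))" .
  qed
  finally show ?thesis .
qed

text \<open>This is the Laplace integrand pulled back along \<open>t \<mapsto> t * exp (\<i> * \<theta>)\<close> to the positive reals,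
  with the Jacobian factor \<open>cis \<theta>\<close>; for \<open>\<theta> = 0\<close> it is the integrand of \<^const>\<open>laplace\<close>.\<close>

definition ray_integrand :: "(lpoint \<Rightarrow> complex) \<Rightarrow> complex \<Rightarrow> real \<Rightarrow> real \<Rightarrow> complex" where
  "ray_integrand f z \<theta> t = cis \<theta> * exp (- z * of_real t * cis \<theta>) * f (t, \<theta>)"

lemma lholomorphic_continuous_on_ray:
  assumes "lholomorphic_on f (lsector a b)" "\<theta> \<in> {a..b}"
  shows "continuous_on {0<..} (\<lambda>t. f (t, \<theta>))"
proof -
  have "continuous_on {w. of_log w \<in> lsector a b} (\<lambda>w. f (of_log w))"
    using assms(1) unfolding lholomorphic_on_def by (rule holomorphic_on_imp_continuous_on)
  then have "continuous_on {0<..} (\<lambda>t. f (of_log (of_real (ln t) + \<i> * of_real \<theta>)))"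
    by (rule continuous_on_compose2)
      (use assms(2) in \<open>auto simp: of_log_def lsector_def intro!: continuous_intros\<close>)
  then show ?thesis
    by (rule continuous_on_cong[THEN iffD1, rotated 2]) (auto simp: of_log_def)
qed

context
  fixes f :: "lpoint \<Rightarrow> complex" and a b A \<sigma> k :: real and z :: complex
  assumes holo: "lholomorphic_on f (lsector a b)"
    and growth: "\<And>t. t \<in> lsector a b \<Longrightarrow> norm (f t) \<le> A * exp (\<sigma> * fst t)"
    and "k > 0"
begin

lemma norm_ray_integrand_le:
  assumes "\<eta> \<in> {a..b}" "Re (z * cis \<eta>) \<ge> \<sigma> + k" "t > 0"
  shows "norm (ray_integrand f z \<eta> t) \<le> A * exp (- k * t)"
proof -
  have "norm (f (t, \<eta>)) \<le> A * exp (\<sigma> * t)"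
    using growth[of "(t, \<eta>)"] assms by (simp add: lsector_def)
  moreover have "exp (- (t * Re (z * cis \<eta>))) \<le> exp (- (t * (\<sigma> + k)))"
    using assms by (simp add: mult_left_mono)
  moreover have "norm (exp (- z * of_real t * cis \<eta>)) = exp (- (t * Re (z * cis \<eta>)))"
    by (simp add: norm_exp_eq_Re algebra_simps)
  ultimately have "norm (ray_integrand f z \<eta> t) \<le> exp (- (t * (\<sigma> + k))) * (A * exp (\<sigma> * t))"
    unfolding ray_integrand_def norm_mult by (simp add: mult_mono)
  also have "\<dots> = A * exp (- k * t)"
    by (simp add: algebra_simps flip: exp_add)
  finally show ?thesis .
qed

lemma continuous_on_ray_integrand:
  assumes "\<eta> \<in> {a..b}"
  shows "continuous_on {0<..} (ray_integrand f z \<eta>)"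
  unfolding ray_integrand_def[abs_def]
  by (intro continuous_intros lholomorphic_continuous_on_ray[OF holo assms])

lemma set_integrable_ray_integrand:
  assumes "\<eta> \<in> {a..b}" "Re (z * cis \<eta>) \<ge> \<sigma> + k"
  shows "set_integrable lborel {0<..} (ray_integrand f z \<eta>)"
proof (rule set_integrable_bound)
  show "set_integrable lborel {0<..} (\<lambda>t. A * exp (- k * t))"
    using set_integrable_exp_decay(1)[OF \<open>k > 0\<close>] by (rule set_integrable_mult_right)
  show "set_borel_measurable lborel {0<..} (ray_integrand f z \<eta>)"
    using continuous_on_ray_integrand[OF assms(1)]
    unfolding set_borel_measurable_def by (simp add: borel_measurable_continuous_on_indicator)
  show "AE t in lborel. t \<in> {0<..} \<longrightarrow> norm (ray_integrand f z \<eta> t) \<le> norm (A * exp (- k * t))"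
    using norm_ray_integrand_le[OF assms] by (intro AE_I2) (force intro: order_trans[OF _ abs_ge_self])
qed

text \<open>In the coordinate \<open>w = log t\<close> the integrands on the rays are the restrictions of a single
  holomorphic function \<open>G\<close> to horizontal lines. By the growth bound, \<open>G\<close> is at most
  \<open>A * exp x * exp (- k * exp x)\<close> on the vertical segment \<open>Re w = x\<close>. This tends to \<open>0\<close> at both
  ends: on the left since \<open>f\<close> is bounded near the branch point while \<open>exp x\<close> vanishes, on the
  right by exponential decay. Hence the lines have the same integral.\<close>

lemma laplace_ray_rotation:
  assumes "0 \<in> {a..b}" "\<theta> \<in> {a..b}"
    and decay: "\<And>\<eta>. \<eta> \<in> closed_segment 0 \<theta> \<Longrightarrow> Re (z * cis \<eta>) \<ge> \<sigma> + k"
  shows "(LBINT t:{0<..}. ray_integrand f z 0 t) = (LBINT t:{0<..}. ray_integrand f z \<theta> t)"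
proof -
  define G where "G = (\<lambda>w. exp w * exp (- z * exp w) * f (of_log w))"
  define B where "B = (\<lambda>x. exp x * (A * exp (- k * exp x)))"
  define N where "N = (\<lambda>n. real (Suc n))"
  have seg: "\<eta> \<in> {a..b}" if "\<eta> \<in> closed_segment 0 \<theta>" for \<eta>
    using that assms(1,2) by (metis closed_segment_subset convex_real_interval(5) subsetD)
  have polar: "G w = exp (Re w) *\<^sub>R ray_integrand f z (Im w) (exp (Re w))" for w
    by (simp add: G_def ray_integrand_def of_log_def exp_eq_polar[of w] scaleR_conv_of_real mult_ac)
  have holG: "G holomorphic_on {w. Im w \<in> closed_segment 0 \<theta>}"
  proof -
    have "(\<lambda>w. f (of_log w)) holomorphic_on {w. Im w \<in> closed_segment 0 \<theta>}"
      using holo unfolding lholomorphic_on_def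
      by (rule holomorphic_on_subset) (use seg in \<open>auto simp: of_log_def lsector_def\<close>)
    then show ?thesis
      unfolding G_def by (intro holomorphic_intros)
  qed
  have bound: "norm (G w) \<le> B x" if "w \<in> {w. Im w \<in> closed_segment 0 \<theta>}" "Re w = x" for w x
    using that norm_ray_integrand_le[OF seg decay, of "Im w" "exp (Re w)"]
    unfolding polar B_def by simp
  have lim: "(\<lambda>n. integral {- N n..N n} (\<lambda>u. G (of_real u + \<i> * of_real \<eta>)))
      \<longlonglongrightarrow> (LBINT t:{0<..}. ray_integrand f z \<eta> t)" if "\<eta> \<in> closed_segment 0 \<theta>" for \<eta>
    using integral_exp_substitution_tendsto[OF continuous_on_ray_integrand set_integrable_ray_integrand,
        OF seg seg decay, OF that that that]
    by (simp add: polar N_def)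
  have "(\<lambda>n. integral {- N n..N n} (\<lambda>u. G (of_real u)) -
      integral {- N n..N n} (\<lambda>u. G (of_real u + \<i> * of_real \<theta>))) \<longlonglongrightarrow> 0"
  proof (rule Lim_null_comparison)
    show "\<forall>\<^sub>F n in sequentially. norm (integral {- N n..N n} (\<lambda>u. G (of_real u)) -
        integral {- N n..N n} (\<lambda>u. G (of_real u + \<i> * of_real \<theta>))) \<le> (B (- N n) + B (N n)) * \<bar>\<theta>\<bar>"
      by (intro always_eventually allI Cauchy_horizontal_segments[OF _ holG bound bound])
        (auto simp: N_def)
    have "(\<lambda>n. B (- N n)) \<longlonglongrightarrow> 0" "(\<lambda>n. B (N n)) \<longlonglongrightarrow> 0"
      using \<open>k > 0\<close> unfolding B_def N_def by real_asymp+
    from tendsto_mult_right[OF tendsto_add[OF this], of "\<bar>\<theta>\<bar>"]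
    show "(\<lambda>n. (B (- N n) + B (N n)) * \<bar>\<theta>\<bar>) \<longlonglongrightarrow> 0"
      by (simp add: mult.commute)
  qed
  moreover have "(\<lambda>n. integral {- N n..N n} (\<lambda>u. G (of_real u)) -
      integral {- N n..N n} (\<lambda>u. G (of_real u + \<i> * of_real \<theta>)))
      \<longlonglongrightarrow> (LBINT t:{0<..}. ray_integrand f z 0 t) - (LBINT t:{0<..}. ray_integrand f z \<theta> t)"
    using tendsto_diff[OF lim lim, of 0 \<theta>] by simp
  ultimately show ?thesis
    using LIMSEQ_unique by fastforce
qed

end

section \<open>The remainder on the rotated ray\<close>

lemma norm_lpow:
  assumes "0 < fst t"
  shows "norm (lpow t s) = fst t powr Re s * exp (- (Im s * snd t))"
  using assms by (simp add: lpow_def norm_mult norm_powr_real_powr norm_exp_eq_Re)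

lemma mult_cis_eq: "z * cis \<eta> = of_real (norm z) * cis (Arg z + \<eta>)"
proof -
  have "z * cis \<eta> = rcis (norm z) (Arg z) * rcis 1 \<eta>"
    by (simp only: rcis_cmod_Arg cis_rcis_eq)
  also have "\<dots> = of_real (norm z) * cis (Arg z + \<eta>)"
    by (subst rcis_mult) (simp add: rcis_def)
  finally show ?thesis .
qed

text \<open>The ray \<open>arg t = - Arg z\<close> is the one on which the Laplace kernel is real and decays
  fastest.\<close>

lemma exp_ray:
  "exp (- z * of_real t * cis (- Arg z)) = exp (- of_real (norm z * t))"
proof -
  have "z * cis (- Arg z) = of_real (norm z)"
    by (subst mult_cis_eq) simp
  moreover have "- z * of_real t * cis (- Arg z) = - (z * cis (- Arg z) * of_real t)"
    by simp
  ultimately show ?thesis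
    by (simp only: of_real_mult)
qed

text \<open>The phases \<open>exp (- \<i> * s * Arg z)\<close> from the rotated power and \<open>z powr s\<close> match, which turns
  Euler's integral with the real parameter \<open>norm z\<close> into the principal power of \<open>z\<close>.\<close>

lemma ray_integral_lpow:
  fixes z s :: complex
  assumes z: "z \<noteq> 0" and s: "Re s > 0"
  shows "set_integrable lborel {0<..} (ray_integrand (\<lambda>t. lpow t (s - 1)) z (- Arg z))"
    and "(LBINT t:{0<..}. ray_integrand (\<lambda>t. lpow t (s - 1)) z (- Arg z) t) = Gamma s / z powr s"
proof -
  define E where "E = exp (- (\<i> * s * of_real (Arg z)))"
  define x where "x = norm z"
  have x: "x > 0"
    using z by (simp add: x_def)
  have E: "cis (- Arg z) * exp (\<i> * (s - 1) * of_real (- Arg z)) = E"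
    by (simp add: E_def cis_conv_exp algebra_simps flip: exp_add)
  have eq: "ray_integrand (\<lambda>t. lpow t (s - 1)) z (- Arg z) =
      (\<lambda>t. E * (exp (- of_real (x * t)) * of_real t powr (s - 1)))"
    unfolding ray_integrand_def[abs_def] lpow_def exp_ray E[symmetric] x_def by (simp add: mult_ac)
  show "set_integrable lborel {0<..} (ray_integrand (\<lambda>t. lpow t (s - 1)) z (- Arg z))"
    unfolding eq by (intro set_integrable_mult_right laplace_powr x s)
  have "z powr s = exp (s * (of_real (ln x) + \<i> * of_real (Arg z)))"
    using z by (simp add: powr_def Ln_Arg x_def)
  also have "\<dots> = of_real x powr s / E"
    using x by (simp add: powr_def E_def exp_minus exp_add Ln_of_real divide_inverse algebra_simps)
  finally have "z powr s = of_real x powr s / E" .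
  then show "(LBINT t:{0<..}. ray_integrand (\<lambda>t. lpow t (s - 1)) z (- Arg z) t) = Gamma s / z powr s"
    unfolding eq set_integral_mult_right laplace_powr(2)[OF x s] by simp
qed

text \<open>The reason for truncating where the exponent \<open>a n\<close> crosses \<open>X\<close>: beyond the radius (\<open>q \<ge> 1\<close>)
  every retained power \<open>q powr a n\<close> is at most \<open>q powr X\<close>, and inside it (\<open>q \<le> 1\<close>) so is every
  discarded one. The head and the tail thus obey one and the same bound, on complementary
  ranges of \<open>q\<close>.\<close>

lemma truncated_powr_series_bound:
  fixes d :: "nat \<Rightarrow> complex" and a b :: "nat \<Rightarrow> real" and q X :: real
  assumes d: "\<And>n. norm (d n) \<le> b n * q powr a n"
    and b: "\<And>n. 0 \<le> b n" "summable b"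
    and D: "finite D" "\<And>n. n \<in> D \<Longrightarrow> a n \<le> X" "\<And>n. n \<notin> D \<Longrightarrow> X \<le> a n"
  shows truncated_powr_series_head: "1 \<le> q \<Longrightarrow> norm (sum d D) \<le> suminf b * q powr X"
    and truncated_powr_series_tail:
      "0 < q \<Longrightarrow> q \<le> 1 \<Longrightarrow> d sums s \<Longrightarrow> norm (s - sum d D) \<le> suminf b * q powr X"
proof -
  assume q: "1 \<le> q"
  have "norm (sum d D) \<le> (\<Sum>n\<in>D. b n * q powr X)"
  proof (rule sum_norm_le)
    fix n assume "n \<in> D"
    then have "b n * q powr a n \<le> b n * q powr X"
      using q by (intro mult_left_mono powr_mono D b)
    then show "norm (d n) \<le> b n * q powr X"
      using d[of n] by linarith
  qed
  also have "\<dots> \<le> suminf b * q powr X"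
    unfolding sum_distrib_right[symmetric]
    using b D by (intro mult_right_mono sum_le_suminf) auto
  finally show "norm (sum d D) \<le> suminf b * q powr X" .
next
  assume q: "0 < q" "q \<le> 1" and s: "d sums s"
  define e where "e = (\<lambda>n. d n - (if n \<in> D then d n else 0))"
  have "e sums (s - sum d D)"
    unfolding e_def by (intro sums_diff s sums_If_finite_set D)
  moreover have "norm (e n) \<le> b n * q powr X" for n
  proof (cases "n \<in> D")
    case False
    then have "b n * q powr a n \<le> b n * q powr X"
      using q by (intro mult_left_mono powr_mono' D b) auto
    then show ?thesis
      using False d[of n] by (simp add: e_def)
  qed (use b in \<open>simp add: e_def\<close>)
  ultimately have "norm (s - sum d D) \<le> (\<Sum>n. b n * q powr X)"
    using norm_suminf_le[of e] b by (metis summable_mult2 sums_unique)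
  also have "\<dots> = suminf b * q powr X"
    using b by (simp add: suminf_mult2)
  finally show "norm (s - sum d D) \<le> suminf b * q powr X" .
qed

text \<open>The function \<open>t powr (r * x) * exp (- (x * t))\<close> has its maximum at \<open>t = r\<close>. By
  \<open>ln y \<le> y - 1\<close> at \<open>y = t / \<rho>\<close>, normalising by \<open>\<rho>\<close> yields the factor \<open>exp (- (r * x))\<close>
  while, for \<open>r < \<rho>\<close>, a decaying exponential in \<open>t\<close> is left over for the integration.\<close>

lemma powr_mult_exp_le:
  fixes r x \<rho> t :: real
  assumes "0 < r" "0 \<le> x" "0 < \<rho>" "0 < t"
  shows "(t / \<rho>) powr (r * x) * exp (- (x * t)) \<le> exp (- (r * x)) * exp (- ((1 - r / \<rho>) * x * t))"
proof -
  have "(t / \<rho>) powr (r * x) = exp (r * x * ln (t / \<rho>))"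
    using assms by (simp add: powr_def)
  also have "\<dots> \<le> exp (r * x * (t / \<rho> - 1))"
    unfolding exp_le_cancel_iff using assms by (intro mult_left_mono ln_le_minus_one) auto
  finally have "(t / \<rho>) powr (r * x) * exp (- (x * t)) \<le> exp (r * x * (t / \<rho> - 1)) * exp (- (x * t))"
    by simp
  also have "\<dots> = exp (- (r * x)) * exp (- ((1 - r / \<rho>) * x * t))"
    using assms by (simp add: field_simps flip: exp_add)
  finally show ?thesis .
qed

text \<open>The counterpart for the part of the ray outside the disc, where only the growth bound on
  \<open>f\<close> is available: \<open>x * t\<close> exceeds \<open>(1 - r / \<rho>) * x * t\<close> by \<open>r * x * t / \<rho> \<ge> r * x\<close>.\<close>

lemma exp_mult_exp_le:
  fixes r x \<rho> t :: real
  assumes "0 < r" "0 \<le> x" "0 < \<rho>" "\<rho> \<le> t"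
  shows "exp (- (x * t)) \<le> exp (- (r * x)) * exp (- ((1 - r / \<rho>) * x * t))"
proof -
  have "r * x * 1 \<le> r * x * (t / \<rho>)"
    using assms by (intro mult_left_mono) auto
  then show ?thesis
    unfolding exp_add[symmetric] exp_le_cancel_iff using assms by (simp add: algebra_simps)
qed

text \<open>The remainder is a single integral of \<open>f\<close> minus its truncated expansion, and the integrand
  satisfies one bound on the whole ray. For \<open>t \<le> \<rho>\<close> the difference is the tail of the series; for
  \<open>t > \<rho>\<close> it is estimated by \<open>f\<close> plus the head. The head and the tail are controlled by
  \<open>(t / \<rho>) powr (r * norm z)\<close>, and with the kernel every part becomes at most
  \<open>exp (- r * norm z) * exp (- \<kappa> * t)\<close> up to a constant. The constant
  \<open>\<omega>\<close> accounts for complex exponents: on the ray of angle \<open>\<theta>\<close>, the modulus of the power with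
  exponent \<open>s n - 1\<close> carries the factor \<open>exp (- Im (s n) * \<theta>)\<close>.\<close>

lemma ray_remainder_bound:
  fixes f :: "lpoint \<Rightarrow> complex" and c :: "nat \<Rightarrow> complex" and s :: "nat \<Rightarrow> complex"
    and z :: complex and A \<sigma> r \<rho> \<omega> :: real
  defines "\<theta> \<equiv> - Arg z" and "\<kappa> \<equiv> (1 - r / \<rho>) * norm z - \<sigma>"
  assumes "z \<noteq> 0" "0 < r" "0 < \<rho>" "0 \<le> A" "0 \<le> \<sigma>" and \<kappa>: "0 < \<kappa>"
    and s: "\<And>n. 0 < Re (s n)" "\<And>n. \<bar>Im (s n)\<bar> \<le> \<omega>"
    and summable: "summable (\<lambda>n. norm (c n) * \<rho> powr (Re (s n) - 1))"
    and int: "set_integrable lborel {0<..} (ray_integrand f z \<theta>)"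
    and growth: "\<And>t. 0 < t \<Longrightarrow> norm (f (t, \<theta>)) \<le> A * exp (\<sigma> * t)"
    and expansion: "\<And>t. 0 < t \<Longrightarrow> t \<le> \<rho> \<Longrightarrow> (\<lambda>n. c n * lpow (t, \<theta>) (s n - 1)) sums f (t, \<theta>)"
    and D: "finite D" "\<And>n. n \<in> D \<Longrightarrow> Re (s n) - 1 \<le> r * norm z"
      "\<And>n. n \<notin> D \<Longrightarrow> r * norm z \<le> Re (s n) - 1"
  shows "norm ((LBINT t:{0<..}. ray_integrand f z \<theta> t) - (\<Sum>n\<in>D. c n / z powr s n * Gamma (s n)))
    \<le> (A + exp (\<omega> * pi) * (\<Sum>n. norm (c n) * \<rho> powr (Re (s n) - 1))) * exp (- r * norm z) / \<kappa>"
proof -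
  define x where "x = norm z"
  define b where "b = (\<lambda>n. exp (\<omega> * pi) * (norm (c n) * \<rho> powr (Re (s n) - 1)))"
  define C where "C = A + suminf b"
  define d where "d = (\<lambda>t n. c n * lpow (t, \<theta>) (s n - 1))"
  define h where "h = (\<lambda>t. ray_integrand f z \<theta> t -
      (\<Sum>n\<in>D. c n * ray_integrand (\<lambda>t. lpow t (s n - 1)) z \<theta> t))"
  have b: "summable b" "b n \<ge> 0" for n
    using summable by (auto simp: b_def intro: summable_mult)
  have M: "0 \<le> suminf b"
    by (intro suminf_nonneg b)
  have d_le: "norm (d t n) \<le> b n * (t / \<rho>) powr (Re (s n) - 1)" if "0 < t" for t n
  proof -
    have "- (Im (s n) * \<theta>) \<le> \<bar>Im (s n)\<bar> * \<bar>\<theta>\<bar>"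
      by (metis abs_ge_minus_self abs_mult)
    also have "\<dots> \<le> \<omega> * pi"
      using s(2)[of n] Arg_bounded[of z] by (intro mult_mono) (auto simp: \<theta>_def)
    finally have "exp (- (Im (s n) * \<theta>)) \<le> exp (\<omega> * pi)"
      by simp
    moreover have "\<rho> powr a * (t / \<rho>) powr a = t powr a" for a
      using that \<open>0 < \<rho>\<close> by (simp flip: powr_mult)
    ultimately show ?thesis
      using that by (simp add: d_def b_def norm_mult norm_lpow mult_ac mult_left_mono)
  qed
  have h_le: "norm (h t) \<le> C * exp (- (r * x)) * exp (- \<kappa> * t)" if t: "0 < t" for t
  proof -
    let ?X = "exp (- (r * x)) * exp (- ((1 - r / \<rho>) * x * t))"
    have "norm (f (t, \<theta>) - sum (d t) D) * exp (- (x * t)) \<le> (A * exp (\<sigma> * t) + suminf b) * ?X"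
    proof (cases "t \<le> \<rho>")
      case True
      have "norm (f (t, \<theta>) - sum (d t) D) \<le> suminf b * (t / \<rho>) powr (r * x)"
        using t True \<open>0 < \<rho>\<close> expansion[OF t True] unfolding x_def
        by (intro truncated_powr_series_tail[OF d_le[OF t] b(2) b(1) D]) (auto simp: d_def)
      then have "norm (f (t, \<theta>) - sum (d t) D) * exp (- (x * t))
          \<le> suminf b * ((t / \<rho>) powr (r * x) * exp (- (x * t)))"
        by (simp add: mult_right_mono flip: mult.assoc)
      also have "\<dots> \<le> suminf b * ?X"
        using assms(4,5) t by (intro mult_left_mono powr_mult_exp_le M) (auto simp: x_def)
      also have "\<dots> \<le> (A * exp (\<sigma> * t) + suminf b) * ?X"
        using \<open>0 \<le> A\<close> by (intro mult_right_mono) auto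
      finally show ?thesis .
    next
      case False
      have "norm (f (t, \<theta>) - sum (d t) D) \<le> norm (f (t, \<theta>)) + norm (sum (d t) D)"
        by (rule norm_triangle_ineq4)
      also have "\<dots> \<le> A * exp (\<sigma> * t) + suminf b * (t / \<rho>) powr (r * x)"
        using t False \<open>0 < \<rho>\<close> unfolding x_def
        by (intro add_mono growth truncated_powr_series_head[OF d_le[OF t] b(2) b(1) D]) auto
      finally have "norm (f (t, \<theta>) - sum (d t) D) * exp (- (x * t))
          \<le> A * exp (\<sigma> * t) * exp (- (x * t)) + suminf b * ((t / \<rho>) powr (r * x) * exp (- (x * t)))"
        by (metis (no_types, lifting) distrib_right exp_ge_zero mult.assoc mult_right_mono)
      also have "\<dots> \<le> A * exp (\<sigma> * t) * ?X + suminf b * ?X"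
        using assms(4-6) t False
        by (intro add_mono mult_left_mono powr_mult_exp_le exp_mult_exp_le M) (auto simp: x_def)
      finally show ?thesis
        by (simp add: distrib_right)
    qed
    also have "\<dots> \<le> (A * exp (\<sigma> * t) + suminf b * exp (\<sigma> * t)) * ?X"
      using M \<open>0 \<le> \<sigma>\<close> t by (intro mult_right_mono add_left_mono) (auto simp: mult_le_cancel_left1)
    also have "\<dots> = C * exp (- (r * x)) * exp (- \<kappa> * t)"
      by (simp add: C_def \<kappa>_def x_def algebra_simps flip: exp_add)
    also have "norm (f (t, \<theta>) - sum (d t) D) * exp (- (x * t)) = norm (h t)"
    proof -
      have "h t = cis \<theta> * exp (- of_real (x * t)) * (f (t, \<theta>) - sum (d t) D)"
        unfolding h_def ray_integrand_def \<theta>_def exp_ray d_def x_def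
        by (simp add: right_diff_distrib sum_distrib_left mult_ac)
      then show ?thesis
        by (simp add: norm_mult norm_exp_eq_Re mult_ac)
    qed
    finally show ?thesis .
  qed
  have ints: "set_integrable lborel {0<..} (\<lambda>t. c n * ray_integrand (\<lambda>t. lpow t (s n - 1)) z \<theta> t)" for n
    unfolding \<theta>_def by (intro set_integrable_mult_right ray_integral_lpow assms(3) s)
  have sum_int: "set_integrable lborel {0<..}
      (\<lambda>t. \<Sum>n\<in>D. c n * ray_integrand (\<lambda>t. lpow t (s n - 1)) z \<theta> t)"
    using ints unfolding set_integrable_def scaleR_sum_right by (intro Bochner_Integration.integrable_sum)
  have h_int: "set_integrable lborel {0<..} h"
    unfolding h_def by (intro set_integral_diff int sum_int)
  have "(LBINT t:{0<..}. \<Sum>n\<in>D. c n * ray_integrand (\<lambda>t. lpow t (s n - 1)) z \<theta> t) =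
      (\<Sum>n\<in>D. LBINT t:{0<..}. c n * ray_integrand (\<lambda>t. lpow t (s n - 1)) z \<theta> t)"
    using ints unfolding set_integrable_def set_lebesgue_integral_def scaleR_sum_right
    by (intro Bochner_Integration.integral_sum)
  also have "\<dots> = (\<Sum>n\<in>D. c n / z powr s n * Gamma (s n))"
    unfolding \<theta>_def set_integral_mult_right ray_integral_lpow(2)[OF assms(3) s(1)] by simp
  finally have "(LBINT t:{0<..}. ray_integrand f z \<theta> t) - (\<Sum>n\<in>D. c n / z powr s n * Gamma (s n))
      = (LBINT t:{0<..}. h t)"
    using set_integral_diff(2)[OF int sum_int] by (simp add: h_def)
  also have "norm \<dots> \<le> (LBINT t:{0<..}. norm (h t))"
    by (rule set_integral_norm_bound[OF h_int])
  also have "\<dots> \<le> (LBINT t:{0<..}. C * exp (- (r * x)) * exp (- \<kappa> * t))"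
    using h_le set_integrable_exp_decay(1)[OF \<kappa>]
    by (intro set_integral_mono set_integrable_norm h_int set_integrable_mult_right) auto
  also have "\<dots> = C * exp (- (r * x)) / \<kappa>"
    unfolding set_integral_mult_right set_integrable_exp_decay(2)[OF \<kappa>] by simp
  finally show ?thesis
    using suminf_mult[OF summable, of "exp (\<omega> * pi)"] by (simp add: C_def b_def x_def)
qed

section \<open>Watson's lemma with an exponentially small remainder\<close>

theorem theorem2:
  fixes \<delta> \<alpha>1 \<alpha>2 R \<mu> A \<sigma> r :: real
    and \<beta> :: complex
    and c :: "nat \<Rightarrow> complex"
    and f :: "lpoint \<Rightarrow> complex"
  assumes "\<delta> > 0" "\<alpha>1 \<ge> pi / 2" "\<alpha>2 \<ge> pi / 2"
    and "R > 0" "\<mu> > 0" "Re \<beta> > 0"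
    and holo: "lholomorphic_on f (lsector (- \<alpha>1 + \<delta>) (\<alpha>2 - \<delta>))"
    and expansion_abs: "\<And>t. t \<in> lsector (- \<alpha>1 + \<delta>) (\<alpha>2 - \<delta>) \<Longrightarrow> fst t < R \<Longrightarrow>
          summable (\<lambda>n. norm (c n * lpow t ((of_nat n + \<beta>) / of_real \<mu> - 1)))"
    and expansion: "\<And>t. t \<in> lsector (- \<alpha>1 + \<delta>) (\<alpha>2 - \<delta>) \<Longrightarrow> fst t < R \<Longrightarrow>
          (\<lambda>n. c n * lpow t ((of_nat n + \<beta>) / of_real \<mu> - 1)) sums f t"
    and "A > 0" "\<sigma> > 0"
    and growth: "\<And>t. t \<in> lsector (- \<alpha>1 + \<delta>) (\<alpha>2 - \<delta>) \<Longrightarrow> norm (f t) \<le> A * exp (\<sigma> * fst t)"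
    and "0 < r" "r < R"
  shows "(\<forall>\<^sub>F z in inf at_infinity (principal {z. \<bar>Arg z\<bar> \<le> pi / 2 - \<delta>}).
          set_integrable lborel {0<..} (\<lambda>t. exp (- z * complex_of_real t) * f (t, 0)))
    \<and> (\<lambda>z. laplace f z -
          (\<Sum>n | int n \<le> \<lfloor>\<mu> * r * norm z + \<mu> - Re \<beta>\<rfloor>.
             c n / z powr ((of_nat n + \<beta>) / of_real \<mu>) * Gamma ((of_nat n + \<beta>) / of_real \<mu>)))
        \<in> O[inf at_infinity (principal {z. \<bar>Arg z\<bar> \<le> pi / 2 - \<delta>})](\<lambda>z. complex_of_real (exp (- r * norm z)))"
proof -
  define a b where "a = - \<alpha>1 + \<delta>" and "b = \<alpha>2 - \<delta>"
  note sector = holo[folded a_def b_def] expansion_abs[folded a_def b_def]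
    expansion[folded a_def b_def] growth[folded a_def b_def]
  define F where "F = inf at_infinity (principal {z :: complex. \<bar>Arg z\<bar> \<le> pi / 2 - \<delta>})"
  define s where "s = (\<lambda>n. (of_nat n + \<beta>) / complex_of_real \<mu>)"
  define D where "D = (\<lambda>z :: complex. {n. int n \<le> \<lfloor>\<mu> * r * norm z + \<mu> - Re \<beta>\<rfloor>})"
  \<comment> \<open>Any radius strictly between \<open>r\<close> and \<open>R\<close> works: the series converges absolutely at \<open>\<rho>\<close>,
    and \<open>r / \<rho> < 1\<close> leaves room for exponential decay.\<close>
  define \<rho> where "\<rho> = (r + R) / 2"
  define M where "M = (\<Sum>n. norm (c n) * \<rho> powr (Re (s n) - 1))"
  define C where "C = A + exp (\<bar>Im \<beta>\<bar> / \<mu> * pi) * M"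
  have \<rho>: "r < \<rho>" "\<rho> < R" "0 < \<rho>"
    using \<open>r < R\<close> \<open>0 < r\<close> by (auto simp: \<rho>_def)
  have s: "Re (s n) = (real n + Re \<beta>) / \<mu>" "Im (s n) = Im \<beta> / \<mu>" for n
    by (auto simp: s_def)
  \<comment> \<open>The first term ensures decay on all rays swept by the rotation, the second ensures
    \<open>(1 - r / \<rho>) * norm z - \<sigma> \<ge> 1\<close>, and the third \<open>z \<noteq> 0\<close>.\<close>
  define K where "K = max (max ((\<sigma> + 1) / sin \<delta>) ((\<sigma> + 1) / (1 - r / \<rho>))) 1"
  have large: "eventually (\<lambda>z. K \<le> norm z \<and> \<bar>Arg z\<bar> \<le> pi / 2 - \<delta>) F"
    unfolding F_def eventually_inf_principal
    using eventually_at_infinity[of "\<lambda>z :: complex. K \<le> norm z"] by (auto elim: eventually_mono)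
  have key: "set_integrable lborel {0<..} (ray_integrand f z 0) \<and>
      norm (laplace f z - (\<Sum>n\<in>D z. c n / z powr s n * Gamma (s n))) \<le> C * exp (- r * norm z)"
    if K: "K \<le> norm z" and Arg: "\<bar>Arg z\<bar> \<le> pi / 2 - \<delta>" for z
  proof -
    \<comment> \<open>If \<open>\<delta> > pi / 2\<close>, no \<open>z\<close> is admissible and the filter is trivial.\<close>
    have "\<delta> \<le> pi / 2"
      using Arg by linarith
    then have "sin \<delta> > 0" "1 - r / \<rho> > 0"
      using \<open>\<delta> > 0\<close> \<rho> by (auto intro: sin_gt_zero simp: field_simps)
    then have K': "\<sigma> + 1 \<le> sin \<delta> * norm z" "\<sigma> + 1 \<le> (1 - r / \<rho>) * norm z" "z \<noteq> 0"
      using K by (auto simp: K_def pos_divide_le_eq mult.commute)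
    have ab: "0 \<in> {a..b}" "- Arg z \<in> {a..b}"
      using \<open>\<delta> \<le> pi / 2\<close> Arg assms(2,3) by (auto simp: a_def b_def)
    have decay: "Re (z * cis \<eta>) \<ge> \<sigma> + 1" if "\<eta> \<in> closed_segment 0 (- Arg z)" for \<eta>
    proof -
      have "\<bar>Arg z + \<eta>\<bar> \<le> pi / 2 - \<delta>"
        using that Arg by (auto simp: closed_segment_eq_real_ivl split: if_splits)
      then have "cos (pi / 2 - \<delta>) \<le> cos \<bar>Arg z + \<eta>\<bar>"
        using \<open>\<delta> > 0\<close> \<open>\<delta> \<le> pi / 2\<close> by (intro cos_monotone_0_pi_le) auto
      then have "sin \<delta> \<le> cos (Arg z + \<eta>)"
        by (simp add: sin_cos_eq)
      then have "sin \<delta> * norm z \<le> norm z * cos (Arg z + \<eta>)"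
        by (simp add: mult.commute mult_left_mono)
      then show ?thesis
        using K'(1) by (subst mult_cis_eq) simp
    qed
    have int: "set_integrable lborel {0<..} (ray_integrand f z \<eta>)"
      if "\<eta> \<in> {0, - Arg z}" for \<eta>
      using set_integrable_ray_integrand[OF sector(1,4) zero_less_one _ decay] that ab by auto
    have fin: "finite (D z)"
      by (rule finite_subset[of _ "{..nat \<lfloor>\<mu> * r * norm z + \<mu> - Re \<beta>\<rfloor>}"]) (auto simp: D_def)
    \<comment> \<open>The given truncation index is precisely where the real exponents cross \<open>r * norm z\<close>.\<close>
    have D_iff: "n \<in> D z \<longleftrightarrow> Re (s n) - 1 \<le> r * norm z" for n
      using \<open>\<mu> > 0\<close> by (simp add: D_def s le_floor_iff field_simps)
    have abs: "summable (\<lambda>n. norm (c n) * \<rho> powr (Re (s n) - 1))"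
      using sector(2)[of "(\<rho>, 0)"] ab \<rho> by (simp add: lsector_def norm_mult norm_lpow s_def)
    have "laplace f z = (LBINT t:{0<..}. ray_integrand f z 0 t)"
      by (simp add: laplace_def ray_integrand_def)
    also have "\<dots> = (LBINT t:{0<..}. ray_integrand f z (- Arg z) t)"
      using sector(1,4) zero_less_one ab decay by (rule laplace_ray_rotation)
    also have "norm (\<dots> - (\<Sum>n\<in>D z. c n / z powr s n * Gamma (s n)))
        \<le> C * exp (- r * norm z) / ((1 - r / \<rho>) * norm z - \<sigma>)"
      unfolding C_def M_def
    proof (rule ray_remainder_bound)
      show "norm (f (t, - Arg z)) \<le> A * exp (\<sigma> * t)" if "0 < t" for t
        using sector(4)[of "(t, - Arg z)"] ab that by (simp add: lsector_def)
      show "(\<lambda>n. c n * lpow (t, - Arg z) (s n - 1)) sums f (t, - Arg z)" if "0 < t" "t \<le> \<rho>" for t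
        using sector(3)[of "(t, - Arg z)"] ab that \<rho> by (simp add: lsector_def s_def)
      show "0 < Re (s n)" "\<bar>Im (s n)\<bar> \<le> \<bar>Im \<beta>\<bar> / \<mu>" for n
        using \<open>Re \<beta> > 0\<close> \<open>\<mu> > 0\<close> by (simp_all add: s abs_divide)
      show "set_integrable lborel {0<..} (ray_integrand f z (- Arg z))"
        by (rule int) simp
    qed (use K' fin D_iff abs \<rho> \<open>A > 0\<close> \<open>\<sigma> > 0\<close> \<open>0 < r\<close> in \<open>simp_all add: less_imp_le\<close>)
    also have "\<dots> \<le> C * exp (- r * norm z) / 1"
    proof (rule divide_left_mono)
      have "0 \<le> M"
        unfolding M_def by (intro suminf_nonneg abs) auto
      then show "0 \<le> C * exp (- r * norm z)"
        using \<open>A > 0\<close> by (auto simp: C_def)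
    qed (use K' in auto)
    finally show ?thesis
      using int by simp
  qed
  have "eventually (\<lambda>z. set_integrable lborel {0<..} (\<lambda>t. exp (- z * complex_of_real t) * f (t, 0))) F"
    using large by eventually_elim (use key in \<open>auto simp: ray_integrand_def[abs_def]\<close>)
  moreover have "(\<lambda>z. laplace f z - (\<Sum>n\<in>D z. c n / z powr s n * Gamma (s n)))
      \<in> O[F](\<lambda>z. complex_of_real (exp (- r * norm z)))"
    by (rule bigoI[of _ C], use large in eventually_elim) (use key in auto)
  ultimately show ?thesis
    unfolding F_def D_def s_def by blast
qed

end
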